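(* Let $(p_n)_{n=1}^\infty$ be a sequence of complex polynomials with $\deg p_1\geq 1$ and $\deg p_n\geq 2$ for $n\in\{2,3,\dots\}$. Define $\alpha:=\limsup_{n\to\infty}\frac{1}{\deg p_n}$. Assume that there exist an $r>0$ and a function $h:\mathbb{C}\to\mathbb{R}$ satisfying $h(z)-\alpha\log|z|\to\infty$ as $|z|\to\infty$ such that (i) $\bigcup_{n=1}^\infty p_n^{-1}(0)\subset\overline{\mathbb{D}}(0,r)$; (ii) for every $z\in\mathbb{C}\setminus\overline{\mathbb{D}}(0,r)$ there exist a neighbourhood $U$ of $z$ and an integer $N=N(U)>1$ such that for all $n\geq N$ and all $\zeta\in U$: $\frac{1}{\deg p_n}\log^+|p_n(\zeta)|>h(\zeta)$. Then there exists $\varrho>0$ such that for all $R\geq\varrho$ and all $n\geq 2$: $p_n^{-1}\left(\overline{\mathbb{D}}(0,R)\right)\subset\overline{\mathbb{D}}(0,R)$.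
   Context: Notation: $\overline{\mathbb{D}}(a,R)=\{z\in\mathbb{C}:|z-a|\leq R\}$ and $\log^+ x=\max\{0,\log x\}$ (with $\log^+0=0$). *)

theory Defs
  imports "HOL-Analysis.Analysis" "HOL-Computational_Algebra.Polynomial"
begin

definition log_plus :: "real \<Rightarrow> real" where
  "log_plus x = max 0 (ln x)"

(* The convention log^+ 0 = 0 holds because ln 0 = 0 in the library. *)
lemma log_plus_0: "log_plus 0 = 0"
  by (simp add: log_plus_def)

end

theory Submission
  imports Defs "HOL-Computational_Algebra.Fundamental_Theorem_Algebra"
begin

text \<open>
  Everything follows from comparing values of a polynomial at two points outside the disc that
  contains its zeros. If \<open>p\<close> has degree \<open>d\<close> and all its zeros lie in \<open>cball 0 r\<close>, then
  factoring \<open>p\<close> gives \<open>\<bar>p z\<bar> \<ge> ((\<bar>z\<bar> - r) / (\<bar>w\<bar> + r)) ^ d * \<bar>p w\<bar>\<close>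
  whenever \<open>\<bar>z\<bar> \<ge> r\<close> (\<open>norm_poly_ge_of_zeros_in_cball\<close>). So once the values
  \<open>\<bar>p\<^sub>n w\<bar>\<close> at one fixed point \<open>w\<close> are bounded below by some \<open>c > 0\<close>, the condition
  \<open>deg p\<^sub>n \<ge> 2\<close> makes \<open>\<bar>p\<^sub>n z\<bar>\<close> grow at least quadratically in \<open>\<bar>z\<bar>\<close>, with constants
  that do not depend on \<open>n\<close>. Hence \<open>\<bar>p\<^sub>n z\<bar> \<ge> \<bar>z\<bar>\<close> for all large \<open>\<bar>z\<bar>\<close>, uniformly in \<open>n\<close>
  (\<open>uniform_escape_radius\<close>), and then for large \<open>R\<close> no point outside
  \<open>cball 0 R\<close> is mapped into it.

  The point \<open>w\<close> comes from the growth of \<open>h\<close>. Since \<open>\<alpha>\<close>, a limsup of nonnegative numbers, is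
  nonnegative, \<open>h\<close> is nonnegative near infinity; at a point \<open>w\<close> with \<open>h w \<ge> 0\<close> outside the disc the lower estimate
  on \<open>log\<^sup>+ \<bar>p\<^sub>n w\<bar>\<close> says \<open>\<bar>p\<^sub>n w\<bar> > 1\<close> for all but finitely many \<open>n\<close>, and the
  remaining values are nonzero because \<open>w\<close> is outside the disc that contains all zeros.
\<close>

text \<open>
  For each zero \<open>a\<close> the triangle inequality gives \<open>\<bar>z - a\<bar> \<ge> \<bar>z\<bar> - r\<close> and
  \<open>\<bar>w - a\<bar> \<le> \<bar>w\<bar> + r\<close>, so passing from \<open>w\<close> to \<open>z\<close> multiplies each of the \<open>degree p\<close>
  linear factors by at least the stated ratio. The induction splits off one zero at a time.
\<close>
lemma norm_poly_ge_of_zeros_in_cball: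
  fixes p :: "complex poly"
  assumes zeros: "\<And>x. poly p x = 0 \<Longrightarrow> norm x \<le> r"
    and "r > 0" "r \<le> norm z"
  shows "((norm z - r) / (norm w + r)) ^ degree p * norm (poly p w) \<le> norm (poly p z)"
  using zeros
proof (induction "degree p" arbitrary: p)
  case 0
  then obtain c where "p = [:c:]"
    by (metis degree_0_id)
  then show ?case by simp
next
  case (Suc d)
  let ?q = "(norm z - r) / (norm w + r)"
  obtain a where a: "poly p a = 0"
    using fundamental_theorem_of_algebra[of p] Suc.hyps(2) by (auto simp: constant_degree)
  then obtain g where p: "p = [:-a, 1:] * g"
    by (auto simp: poly_eq_0_iff_dvd)
  have "g \<noteq> 0" using p Suc.hyps(2) by auto
  have deg: "degree p = Suc (degree g)"
    using \<open>g \<noteq> 0\<close> unfolding p by (subst degree_mult_eq) auto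
  have IH: "?q ^ degree g * norm (poly g w) \<le> norm (poly g z)"
    using Suc.hyps Suc.prems deg by (intro Suc.hyps(1)) (auto simp: p)
  have "norm a \<le> r" using Suc.prems a by blast
  have "?q * norm (w - a) \<le> ?q * (norm w + r)"
    using norm_triangle_ineq4[of w a] \<open>norm a \<le> r\<close> assms by (intro mult_left_mono) auto
  also have "\<dots> = norm z - r" using \<open>r > 0\<close> norm_ge_zero[of w]
    by (simp add: add_nonneg_eq_0_iff)
  also have "\<dots> \<le> norm (z - a)"
    using norm_triangle_ineq2[of z a] \<open>norm a \<le> r\<close> by linarith
  finally have factor: "?q * norm (w - a) \<le> norm (z - a)" .
  have "(?q * norm (w - a)) * (?q ^ degree g * norm (poly g w))
      \<le> norm (z - a) * norm (poly g z)"
    using factor IH assms by (intro mult_mono) auto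
  moreover have "norm (poly p x) = norm (x - a) * norm (poly g x)" for x
    by (simp add: p norm_mult flip: left_diff_distrib)
  ultimately show ?case
    by (simp only: deg power_Suc mult_ac)
qed

text \<open>
  The radius is chosen before the polynomial, from \<open>c\<close>, \<open>w\<close> and \<open>r\<close> alone: this is what
  makes one radius serve a whole sequence.
\<close>
lemma uniform_escape_radius:
  fixes w :: complex
  assumes "r > 0" "c > 0"
  obtains \<rho> where "\<rho> > 0"
    and "\<And>p z. \<lbrakk>2 \<le> degree p; \<And>x. poly p x = 0 \<Longrightarrow> norm x \<le> r; c \<le> norm (poly p w);
           \<rho> \<le> norm z\<rbrakk> \<Longrightarrow> norm z \<le> norm (poly p z)"
proof
  define m where "m = norm w + r"
  have "m > 0" using \<open>r > 0\<close> by (simp add: m_def add_nonneg_pos)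
  (* The first summand lets the quadratic lower bound beat the identity; the other two make
     the base at least 1, so that a degree above 2 only helps, and give norm z \<ge> 2 * r. *)
  define \<rho> where "\<rho> = 4 * m\<^sup>2 / c + m + 2 * r"
  show "\<rho> > 0"
    unfolding \<rho>_def using \<open>m > 0\<close> assms by (intro add_pos_pos) auto
  fix p :: "complex poly" and z :: complex
  assume deg: "2 \<le> degree p" and zeros: "\<And>x. poly p x = 0 \<Longrightarrow> norm x \<le> r"
    and c: "c \<le> norm (poly p w)" and z: "\<rho> \<le> norm z"
  have "4 * m\<^sup>2 / c \<ge> 0" using assms by simp
  then have big: "norm z \<ge> m + 2 * r" and bigc: "norm z \<ge> 4 * m\<^sup>2 / c"
    using z \<open>m > 0\<close> \<open>r > 0\<close> by (auto simp: \<rho>_def)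
  have base: "(norm z - r) / m \<ge> 1"
    using big \<open>m > 0\<close> \<open>r > 0\<close> by (simp add: field_simps)
  have half: "norm z / (2 * m) \<le> (norm z - r) / m"
    using big \<open>m > 0\<close> by (simp add: field_simps)
  have "norm z \<le> (norm z / (2 * m))\<^sup>2 * c"
  proof -
    have "4 * m\<^sup>2 * norm z \<le> (norm z * c) * norm z"
      using bigc \<open>c > 0\<close> by (intro mult_right_mono) (auto simp: field_simps)
    then show ?thesis
      using \<open>m > 0\<close> by (simp add: field_simps power2_eq_square)
  qed
  also have "\<dots> \<le> ((norm z - r) / m)\<^sup>2 * c"
    using half \<open>m > 0\<close> \<open>c > 0\<close> by (intro mult_right_mono power_mono) auto
  also have "\<dots> \<le> ((norm z - r) / m) ^ degree p * norm (poly p w)"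
    using base deg c \<open>c > 0\<close> by (intro mult_mono power_increasing) auto
  also have "\<dots> \<le> norm (poly p z)"
    unfolding m_def using zeros \<open>r > 0\<close> \<open>m > 0\<close> big
    by (intro norm_poly_ge_of_zeros_in_cball) auto
  finally show "norm z \<le> norm (poly p z)" .
qed

lemma one_less_if_log_plus_pos:
  assumes "0 < log_plus x" "0 \<le> x"
  shows "1 < x"
  using assms ln_gt_zero_imp_gt_one[of x] by (cases "x = 0") (auto simp: log_plus_def less_max_iff_disj)

theorem corollary2p2p4:
  fixes p :: "nat \<Rightarrow> complex poly"
    and \<alpha> r :: real
    and h :: "complex \<Rightarrow> real"
  assumes deg1: "degree (p 1) \<ge> 1"
    and deg2: "\<And>n. n \<ge> 2 \<Longrightarrow> degree (p n) \<ge> 2"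
    and alpha: "ereal \<alpha> = limsup (\<lambda>n. ereal (1 / real (degree (p n))))"
    and r_pos: "r > 0"
    and h_growth: "filterlim (\<lambda>z. h z - \<alpha> * ln (norm z)) at_top at_infinity"
    and zeros: "(\<Union>n\<in>{1..}. poly (p n) -` {0}) \<subseteq> cball 0 r"
    and lower: "\<And>z. z \<in> UNIV - cball 0 r \<Longrightarrow>
      \<exists>U N. open U \<and> z \<in> U \<and> N > 1 \<and>
        (\<forall>n\<ge>N. \<forall>\<zeta>\<in>U. 1 / real (degree (p n)) * log_plus (norm (poly (p n) \<zeta>)) > h \<zeta>)"
  shows "\<exists>\<rho>>0. \<forall>R\<ge>\<rho>. \<forall>n\<ge>2. poly (p n) -` cball 0 R \<subseteq> cball 0 R"
proof -
  have zeros': "norm x \<le> r" if "poly (p n) x = 0" "n \<ge> 2" for n x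
    using zeros that by force
  have "ereal 0 \<le> ereal \<alpha>"
    unfolding alpha by (rule le_Limsup) auto
  then have "\<alpha> \<ge> 0" by simp
  have "eventually (\<lambda>z. 0 \<le> h z - \<alpha> * ln (norm z)) at_infinity"
    using h_growth unfolding filterlim_at_top by blast
  then obtain b where b: "\<And>z. norm z \<ge> b \<Longrightarrow> 0 \<le> h z - \<alpha> * ln (norm z)"
    by (auto simp: eventually_at_infinity)
  define w where "w = complex_of_real (max b (r + 1))"
  have norm_w: "norm w = max b (r + 1)"
    using r_pos by (simp add: w_def)
  have "0 \<le> \<alpha> * ln (norm w)"
    using \<open>\<alpha> \<ge> 0\<close> r_pos norm_w by (intro mult_nonneg_nonneg ln_ge_zero) auto
  then have "h w \<ge> 0" using b[of w] norm_w by simp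
  have "w \<in> UNIV - cball 0 r" using norm_w by simp
  from lower[OF this] obtain N where
    N: "\<And>n. n \<ge> N \<Longrightarrow> 1 / real (degree (p n)) * log_plus (norm (poly (p n) w)) > h w"
    by blast
  have tail: "1 < norm (poly (p n) w)" if "n \<ge> N" for n
  proof -
    have "0 < 1 / real (degree (p n)) * log_plus (norm (poly (p n) w))"
      using N[OF that] \<open>h w \<ge> 0\<close> by linarith
    then have "0 < log_plus (norm (poly (p n) w))"
      by (simp add: zero_less_divide_iff)
    then show ?thesis by (rule one_less_if_log_plus_pos) simp
  qed
  define c where "c = Min (insert 1 ((\<lambda>n. norm (poly (p n) w)) ` {2..<N}))"
  have "c > 0"
    using zeros'[of _ w] norm_w by (auto simp: c_def not_le)
  have c: "c \<le> norm (poly (p n) w)" if "n \<ge> 2" for n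
  proof (cases "n < N")
    case True
    then show ?thesis using that unfolding c_def by (intro Min_le) auto
  next
    case False
    have "c \<le> 1" by (simp add: c_def)
    also have "\<dots> \<le> norm (poly (p n) w)" using tail[of n] False by simp
    finally show ?thesis .
  qed
  obtain \<rho> where "\<rho> > 0" and
    \<rho>: "\<And>q z. \<lbrakk>2 \<le> degree q; \<And>x. poly q x = 0 \<Longrightarrow> norm x \<le> r; c \<le> norm (poly q w);
           \<rho> \<le> norm z\<rbrakk> \<Longrightarrow> norm z \<le> norm (poly q z)"
    using uniform_escape_radius[OF r_pos \<open>c > 0\<close>] by blast
  have "norm z \<le> R" if "R \<ge> \<rho>" "n \<ge> 2" "norm (poly (p n) z) \<le> R" for R n z
  proof (rule ccontr)
    assume "\<not> norm z \<le> R"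
    moreover from this have "norm z \<le> norm (poly (p n) z)"
      using that deg2[of n] c[of n] zeros'[of n] by (intro \<rho>) auto
    ultimately show False using that by simp
  qed
  then show ?thesis using \<open>\<rho> > 0\<close> by (intro exI[of _ \<rho>]) auto
qed

end
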